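(* Let $W$ be an $m\times n$ stochastic matrix, not all of whose rows are equal and none of whose columns is identically zero, and let $\hat p$ be a common final output with $\hat p_i>0$ for all $i$, as in the context. Let $R(r,f)$ denote the global rate of convergence of Algorithm III with parameters $(r,f)$ (see context). For every admissible pair $(r,f)$, $$R(r,f)=(1+f_+)\,R(r,0)-f_+ .$$ Consequently, if $(r,f)$ and $(r,\tilde f)$ are both admissible and $f_+\ge\tilde f_+$, then $R(r,f)\le R(r,\tilde f)$.
   Context: Vectors are row vectors except that $1_m$, $1_n$ denote the column vectors of ones; $I_m$ is the identity matrix; inequalities between vectors or matrices are entrywise; $W_i$ is the $i$th row of a matrix $W$. A matrix is stochastic if it has nonnegative entries and all row sums equal to 1. $\Omega=\{p\in\mathbf{R}^{1\times m}: p\ge 0,\ p1_m=1\}$ and $\Omega(r)=\{p\in\Omega: p\ge r\}$. Logarithms are natural, $0\log 0=0$, and $H(q)=-\sum_i q_i\log q_i$ for a nonnegative vector $q$. Admissible pair: nonnegative vectors $r$ ($1\times m$) and $f$ ($1\times n$), with $r_+=r1_m$, $f_+=f1_n$, such that $r_+<1$ and $$\tilde W:=(1+f_+)\frac{I_m-1_m r}{1-r_+}W-1_m f\ \ge 0$$ (then $\tilde W$ is stochastic, and $(r,0)$ is also admissible). The associated vector $c$ is $c_i=H(\tilde W_i)-\frac{1+f_+}{1-r_+}H(W_i)$. Algorithm III with parameters $(r,f)$: choose $p^{(0)}\in\Omega(r)$ with $p^{(0)}_i>0$ for all $i$, and iterate $p^{(t+1)}=M(p^{(t)})$, where for $p$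 with positive entries $$M_i(p)=\max\Big\{r_i,\ \alpha\exp\Big(c_i+\sum_j\tilde W_{ij}\log\Phi_{ji}(p)\Big)\Big\},\qquad \Phi_{ji}(p)=\frac{p_i\tilde W_{ij}}{f_j+\sum_l p_l\tilde W_{lj}},$$ and $\alpha=\alpha(p)>0$ is chosen so that $\sum_i M_i(p)=1$ (terms with $\tilde W_{ij}=0$ contribute $0$). If $p^{(t)}\to p^*$, the final output is $\hat p=(p^*-r)/(1-r_+)$; it maximizes $\sum_i p_i\sum_j W_{ij}\log(W_{ij}/(pW)_j)$ over $p\in\Omega$. Standing assumption: the algorithms under comparison all deliver the same final output $\hat p$, with $\hat p_i>0$ for all $i$; so for parameters $(r,f)$ the limit is $p^*=(1-r_+)\hat p+r$, which satisfies $p^*_i>r_i$ for all $i$ and $M(p^* )=p^*$. The matrix rate is the $m\times m$ matrix $R(p^* )$ with $(k,i)$ entry $\partial M_i/\partial p_k$ at $p^*$ ($p_1,\dots,p_m$ treated as independent variables), and the global rate of convergence $R(r,f)$ is the spectral radius of $R(p^* )$ for parameters $(r,f)$. *)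

theory Defs
  imports
    "HOL-Analysis.Derivative"
    "Jordan_Normal_Form.Spectral_Radius"
begin

text \<open>Row vectors with \<open>m\<close> entries are elements of \<^term>\<open>carrier_vec m\<close>, indexed from \<open>0\<close>. The
  order on vectors and matrices is entrywise and includes equality of dimensions.\<close>

definition vec_total :: "real vec \<Rightarrow> real" where
  "vec_total v = (\<Sum>i<dim_vec v. v $ i)"

definition stochastic :: "real mat \<Rightarrow> bool" where
  "stochastic W \<longleftrightarrow> 0\<^sub>m (dim_row W) (dim_col W) \<le> W \<and> (\<forall>i<dim_row W. vec_total (row W i) = 1)"

text \<open>Since \<open>0 * x = 0\<close>, the convention \<open>0 log 0 = 0\<close> holds here and in \<open>alg_weight\<close> below.\<close>

definition entropy :: "real vec \<Rightarrow> real" where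
  "entropy q = - (\<Sum>i<dim_vec q. q $ i * ln (q $ i))"

definition Omega :: "nat \<Rightarrow> real vec \<Rightarrow> real vec set" where
  "Omega m r = {p \<in> carrier_vec m. 0\<^sub>v m \<le> p \<and> vec_total p = 1 \<and> r \<le> p}"

text \<open>\<open>ones_times m v\<close> is the product of the column of \<open>m\<close> ones with the row vector \<open>v\<close>.\<close>

definition ones_times :: "nat \<Rightarrow> real vec \<Rightarrow> real mat" where
  "ones_times m v = mat m (dim_vec v) (\<lambda>(i, j). v $ j)"

definition Wtilde :: "real mat \<Rightarrow> real vec \<Rightarrow> real vec \<Rightarrow> real mat" where
  "Wtilde W r f =
     ((1 + vec_total f) / (1 - vec_total r)) \<cdot>\<^sub>m ((1\<^sub>m (dim_row W) - ones_times (dim_row W) r) * W)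
       - ones_times (dim_row W) f"

definition admissible :: "real mat \<Rightarrow> real vec \<Rightarrow> real vec \<Rightarrow> bool" where
  "admissible W r f \<longleftrightarrow>
     r \<in> carrier_vec (dim_row W) \<and> f \<in> carrier_vec (dim_col W) \<and>
     0\<^sub>v (dim_row W) \<le> r \<and> 0\<^sub>v (dim_col W) \<le> f \<and> vec_total r < 1 \<and>
     0\<^sub>m (dim_row W) (dim_col W) \<le> Wtilde W r f"

definition cvec :: "real mat \<Rightarrow> real vec \<Rightarrow> real vec \<Rightarrow> real vec" where
  "cvec W r f = vec (dim_row W) (\<lambda>i.
     entropy (row (Wtilde W r f) i)
       - (1 + vec_total f) / (1 - vec_total r) * entropy (row W i))"

definition Phi :: "real mat \<Rightarrow> real vec \<Rightarrow> real vec \<Rightarrow> real vec \<Rightarrow> nat \<Rightarrow> nat \<Rightarrow> real" where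
  "Phi W r f p j i =
     p $ i * Wtilde W r f $$ (i, j) /
       (f $ j + (\<Sum>l<dim_row W. p $ l * Wtilde W r f $$ (l, j)))"

definition alg_weight :: "real mat \<Rightarrow> real vec \<Rightarrow> real vec \<Rightarrow> real vec \<Rightarrow> nat \<Rightarrow> real" where
  "alg_weight W r f p i =
     exp (cvec W r f $ i + (\<Sum>j<dim_col W. Wtilde W r f $$ (i, j) * ln (Phi W r f p j i)))"

text \<open>For positive weights and \<open>vec_total r < 1\<close> there is exactly one normalizing \<open>a\<close>: the sum is
  continuous and increases strictly from the point where it exceeds \<open>vec_total r\<close>. The entries of
  \<open>p\<close> need not add up to \<open>1\<close>.\<close>

definition alg_scale :: "real mat \<Rightarrow> real vec \<Rightarrow> real vec \<Rightarrow> real vec \<Rightarrow> real" where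
  "alg_scale W r f p =
     (THE a. a > 0 \<and> (\<Sum>i<dim_row W. max (r $ i) (a * alg_weight W r f p i)) = 1)"

definition alg_step :: "real mat \<Rightarrow> real vec \<Rightarrow> real vec \<Rightarrow> real vec \<Rightarrow> real vec" where
  "alg_step W r f p =
     vec (dim_row W) (\<lambda>i. max (r $ i) (alg_scale W r f p * alg_weight W r f p i))"

definition final_output :: "real mat \<Rightarrow> real vec \<Rightarrow> real vec \<Rightarrow> real vec \<Rightarrow> bool" where
  "final_output W r f phat \<longleftrightarrow>
     (\<exists>p0 pstar. p0 \<in> Omega (dim_row W) r \<and> (\<forall>i<dim_row W. p0 $ i > 0) \<and>
        pstar \<in> carrier_vec (dim_row W) \<and>
        (\<forall>i<dim_row W. (\<lambda>t. ((alg_step W r f ^^ t) p0) $ i) \<longlonglongrightarrow> pstar $ i) \<and>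
        phat = (1 / (1 - vec_total r)) \<cdot>\<^sub>v (pstar - r))"

definition limit_point :: "real vec \<Rightarrow> real vec \<Rightarrow> real vec" where
  "limit_point r phat = (1 - vec_total r) \<cdot>\<^sub>v phat + r"

definition matrix_rate :: "real mat \<Rightarrow> real vec \<Rightarrow> real vec \<Rightarrow> real vec \<Rightarrow> real mat" where
  "matrix_rate W r f p = mat (dim_row W) (dim_row W) (\<lambda>(k, i).
     deriv (\<lambda>x. alg_step W r f (p |\<^sub>v k \<mapsto> x) $ i) (p $ k))"

text \<open>The rate depends on the parameters also through the point \<open>limit_point r phat\<close>
  at which the matrix rate is taken.\<close>

definition global_rate :: "real mat \<Rightarrow> real vec \<Rightarrow> real vec \<Rightarrow> real vec \<Rightarrow> real" where
  "global_rate W phat r f =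
     spectral_radius (map_mat complex_of_real (matrix_rate W r f (limit_point r phat)))"

end

theory Submission
  imports Defs
begin

unbundle no vec_syntax

text \<open>Near the limit \<open>p\<close> the truncation at \<open>r\<close> is inactive, so that the algorithm map is
  \<open>p \<mapsto> w(p) / \<Sum>w(p)\<close> there. Differentiating at the fixed point gives the matrix rate
  \<open>I - (1 + f\<^sub>+) A + 1 b\<close>, where \<open>A\<close> depends on \<open>W\<close>, \<open>r\<close> and \<open>phat\<close> only, has row sums \<open>1\<close>, and
  the entries of \<open>b\<close> add up to \<open>f\<^sub>+\<close>. So constant vectors lie in the kernel, and modulo constants the
  matrix rate is \<open>I - (1 + f\<^sub>+) A\<close>: its eigenvalues are \<open>0\<close> and \<open>1 - (1 + f\<^sub>+) l\<close> for the eigenvalues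
  \<open>l\<close> of \<open>A\<close> modulo constants. Since \<open>A\<close> is a Gram matrix times \<open>diag(p)\<close>, the \<open>l\<close> are real and
  nonnegative; since \<open>(1 + f\<^sub>+) A - 1 b\<close> is row-stochastic, no \<open>1 - (1 + f\<^sub>+) l\<close> is negative. Hence the
  spectral radius is \<open>1 - (1 + f\<^sub>+) \<mu>\<close>, where \<open>\<mu>\<close> is the least of the \<open>l\<close>.\<close>

subsection \<open>The spectrum modulo constant vectors\<close>

lemma eigenvalue_mat_iff:
  fixes A :: "nat \<Rightarrow> nat \<Rightarrow> complex"
  shows "eigenvalue (mat m m (\<lambda>(i, j). A i j)) k \<longleftrightarrow>
    (\<exists>v. (\<exists>i<m. v i \<noteq> 0) \<and> (\<forall>i<m. (\<Sum>j<m. A i j * v j) = k * v i))"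
proof
  assume "eigenvalue (mat m m (\<lambda>(i, j). A i j)) k"
  then obtain w where w: "w \<in> carrier_vec m" "w \<noteq> 0\<^sub>v m"
    and e: "mat m m (\<lambda>(i, j). A i j) *\<^sub>v w = k \<cdot>\<^sub>v w"
    by (auto simp: eigenvalue_def eigenvector_def)
  have "\<exists>i<m. w $ i \<noteq> 0"
  proof (rule ccontr)
    assume "\<not> ?thesis"
    then have "w = 0\<^sub>v m" using w(1) by (intro eq_vecI) auto
    then show False using w(2) by simp
  qed
  moreover have "(\<Sum>j<m. A i j * w $ j) = k * w $ i" if "i < m" for i
    using arg_cong[OF e, of "\<lambda>x. x $ i"] w that
    by (simp add: scalar_prod_def atLeast0LessThan)
  ultimately show "\<exists>v. (\<exists>i<m. v i \<noteq> 0) \<and> (\<forall>i<m. (\<Sum>j<m. A i j * v j) = k * v i)"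
    by (intro exI[of _ "\<lambda>i. w $ i"]) auto
next
  assume "\<exists>v. (\<exists>i<m. v i \<noteq> 0) \<and> (\<forall>i<m. (\<Sum>j<m. A i j * v j) = k * v i)"
  then obtain v i where i: "i < m" "v i \<noteq> 0" and e: "\<forall>i<m. (\<Sum>j<m. A i j * v j) = k * v i"
    by blast
  have "vec m v $ i \<noteq> 0\<^sub>v m $ i" using i by simp
  then have "vec m v \<noteq> 0\<^sub>v m" by auto
  moreover have "mat m m (\<lambda>(i, j). A i j) *\<^sub>v vec m v = k \<cdot>\<^sub>v vec m v"
    using e by (intro eq_vecI) (auto simp: scalar_prod_def atLeast0LessThan)
  ultimately show "eigenvalue (mat m m (\<lambda>(i, j). A i j)) k"
    unfolding eigenvalue_def eigenvector_def by (intro exI[of _ "vec m v"]) auto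
qed

text \<open>The map induced on the quotient by the constant vectors, whose representatives are
  normalized to have entry \<open>0\<close> at the index \<open>0\<close>.\<close>

definition quotient_mat :: "nat \<Rightarrow> (nat \<Rightarrow> nat \<Rightarrow> complex) \<Rightarrow> complex mat" where
  "quotient_mat m A = mat (m - 1) (m - 1) (\<lambda>(i, j). A (Suc i) (Suc j) - A 0 (Suc j))"

text \<open>Equal row sums mean that \<open>A\<close> maps constants to constants, so it acts on the
  quotient. An eigenvector there lifts to a nonconstant \<open>v\<close> that satisfies the
  eigenvalue equation up to an additive constant \<open>\<kappa>\<close>.\<close>

lemma eigenvalue_quotient_mat:
  assumes m: "m > 0" and rows: "\<And>k. k < m \<Longrightarrow> (\<Sum>i<m. A k i) = c"
  shows "eigenvalue (quotient_mat m A) l \<longleftrightarrow>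
    (\<exists>v \<kappa>. (\<exists>k<m. v k \<noteq> v 0) \<and> (\<forall>k<m. (\<Sum>i<m. A k i * v i) = l * v k + \<kappa>))"
proof -
  obtain d where d: "m = Suc d" using m by (cases m) auto
  have iff: "eigenvalue (quotient_mat m A) l \<longleftrightarrow>
    (\<exists>u. (\<exists>i<d. u i \<noteq> 0) \<and> (\<forall>i<d. (\<Sum>j<d. (A (Suc i) (Suc j) - A 0 (Suc j)) * u j) = l * u i))"
    unfolding quotient_mat_def d diff_Suc_1 by (rule eigenvalue_mat_iff)
  show ?thesis
  proof
    assume "eigenvalue (quotient_mat m A) l"
    then obtain u i where i: "i < d" "u i \<noteq> 0"
      and e: "\<And>i. i < d \<Longrightarrow> (\<Sum>j<d. (A (Suc i) (Suc j) - A 0 (Suc j)) * u j) = l * u i"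
      unfolding iff by blast
    \<comment> \<open>The lift of \<open>u\<close> with entry 0 at index 0; \<open>\<kappa>\<close>
      is then forced by the equation for row 0.\<close>
    define v where "v k = (case k of 0 \<Rightarrow> 0 | Suc j \<Rightarrow> u j)" for k
    define \<kappa> where "\<kappa> = (\<Sum>j<d. A 0 (Suc j) * u j)"
    have Av: "(\<Sum>i<m. A k i * v i) = (\<Sum>j<d. A k (Suc j) * u j)" for k
      unfolding d sum.lessThan_Suc_shift v_def by simp
    have "(\<Sum>i<m. A k i * v i) = l * v k + \<kappa>" if "k < m" for k
    proof (cases k)
      case 0
      then show ?thesis unfolding Av by (simp add: v_def \<kappa>_def)
    next
      case (Suc j)
      with e[of j] that d show ?thesis unfolding Av
        by (simp add: v_def \<kappa>_def algebra_simps sum_subtractf)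
    qed
    moreover have "Suc i < m" "v (Suc i) \<noteq> v 0" using i d by (auto simp: v_def)
    ultimately show "\<exists>v \<kappa>. (\<exists>k<m. v k \<noteq> v 0) \<and> (\<forall>k<m. (\<Sum>i<m. A k i * v i) = l * v k + \<kappa>)"
      by blast
  next
    assume "\<exists>v \<kappa>. (\<exists>k<m. v k \<noteq> v 0) \<and> (\<forall>k<m. (\<Sum>i<m. A k i * v i) = l * v k + \<kappa>)"
    then obtain v \<kappa> k where k: "k < m" "v k \<noteq> v 0"
      and e: "\<And>k. k < m \<Longrightarrow> (\<Sum>i<m. A k i * v i) = l * v k + \<kappa>" by blast
    \<comment> \<open>Passing to the normalized representative changes every row of the equation by
      the same amount \<open>c * v 0\<close>, which drops out when row 0 is subtracted.\<close>
    define u where "u i = v (Suc i) - v 0" for i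
    have shift: "(\<Sum>j<d. A k (Suc j) * u j) = l * v k + \<kappa> - c * v 0" if "k < m" for k
    proof -
      have "(\<Sum>j<d. A k (Suc j) * u j) = (\<Sum>i<m. A k i * (v i - v 0))"
        unfolding d sum.lessThan_Suc_shift u_def by simp
      also have "\<dots> = (\<Sum>i<m. A k i * v i) - (\<Sum>i<m. A k i) * v 0"
        by (simp add: algebra_simps sum_subtractf sum_distrib_left)
      finally show ?thesis using e rows that by simp
    qed
    have "(\<Sum>j<d. (A (Suc i) (Suc j) - A 0 (Suc j)) * u j) = l * u i" if "i < d" for i
    proof -
      have "(\<Sum>j<d. (A (Suc i) (Suc j) - A 0 (Suc j)) * u j)
        = (\<Sum>j<d. A (Suc i) (Suc j) * u j) - (\<Sum>j<d. A 0 (Suc j) * u j)"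
        by (simp add: left_diff_distrib sum_subtractf)
      also have "\<dots> = l * u i"
        using shift[of "Suc i"] shift[of 0] that d unfolding u_def by (simp add: right_diff_distrib)
      finally show ?thesis .
    qed
    moreover obtain i where "k = Suc i" using k by (cases k) auto
    then have "i < d" "u i \<noteq> 0" using k d by (auto simp: u_def)
    ultimately show "eigenvalue (quotient_mat m A) l" unfolding iff by blast
  qed
qed

text \<open>\<open>A\<close> is self-adjoint and positive semidefinite for the inner product
  weighted by \<open>p\<close>, so an eigenvalue is a Rayleigh quotient. The work is to replace an
  eigenvector modulo constants by a true eigenvector.\<close>

lemma eigenvalue_gram_quotient_nonneg:
  fixes V :: "nat \<Rightarrow> nat \<Rightarrow> real" and p w :: "nat \<Rightarrow> real"
  assumes m: "m > 0" and p: "\<And>k. k < m \<Longrightarrow> p k > 0" "(\<Sum>k<m. p k) = 1"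
    and w: "\<And>j. j < n \<Longrightarrow> w j \<ge> 0"
    and A: "\<And>k i. A k i = p i * (\<Sum>j<n. w j * V k j * V i j)"
    and rows: "\<And>k. k < m \<Longrightarrow> (\<Sum>i<m. A k i) = 1"
    and ev: "eigenvalue (quotient_mat m (\<lambda>k i. complex_of_real (A k i))) l"
  shows "l = complex_of_real (Re l)" "Re l \<ge> 0"
proof -
  have "eigenvalue (quotient_mat m (\<lambda>k i. complex_of_real (A k i))) l \<longleftrightarrow>
    (\<exists>v \<kappa>. (\<exists>k<m. v k \<noteq> v 0) \<and> (\<forall>k<m. (\<Sum>i<m. complex_of_real (A k i) * v i) = l * v k + \<kappa>))"
    by (rule eigenvalue_quotient_mat[where c = 1, OF m])
       (simp add: rows flip: of_real_sum)
  with ev obtain v \<kappa> k0 where k0: "k0 < m" "v k0 \<noteq> v 0"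
    and e: "\<And>k. k < m \<Longrightarrow> (\<Sum>i<m. complex_of_real (A k i) * v i) = l * v k + \<kappa>" by blast
  \<comment> \<open>By symmetry of the Gram factor, row sums 1 make \<open>p\<close> a left fixed
    vector of \<open>A\<close>.\<close>
  have left: "(\<Sum>k<m. p k * A k i) = p i" if "i < m" for i
  proof -
    have "(\<Sum>k<m. p k * A k i) = p i * (\<Sum>k<m. A i k)"
      unfolding sum_distrib_left by (intro sum.cong refl) (simp add: A mult_ac)
    with rows that show ?thesis by simp
  qed
  \<comment> \<open>Centering \<open>v\<close> at its \<open>p\<close>-mean \<open>a\<close> gives
    \<open>u\<close> orthogonal to constants. Pairing \<open>A u = l u + \<kappa>'\<close> with the
    left fixed vector \<open>p\<close> then forces \<open>\<kappa>' = 0\<close>.\<close>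
  define a where "a = (\<Sum>k<m. complex_of_real (p k) * v k)"
  define u where "u k = v k - a" for k
  have u0: "(\<Sum>k<m. complex_of_real (p k) * u k) = 0"
    using p(2) unfolding u_def
    by (simp add: right_diff_distrib sum_subtractf a_def flip: sum_distrib_right of_real_sum)
  define \<kappa>' where "\<kappa>' = \<kappa> + l * a - a"
  have Au: "(\<Sum>i<m. complex_of_real (A k i) * u i) = l * u k + \<kappa>'" if "k < m" for k
  proof -
    have "(\<Sum>i<m. complex_of_real (A k i) * u i)
      = (\<Sum>i<m. complex_of_real (A k i) * v i) - complex_of_real (\<Sum>i<m. A k i) * a"
      by (simp add: u_def right_diff_distrib sum_subtractf sum_distrib_right)
    then show ?thesis using e rows that by (simp add: u_def \<kappa>'_def algebra_simps)
  qed
  have "(\<Sum>k<m. complex_of_real (p k) * (\<Sum>i<m. complex_of_real (A k i) * u i))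
    = (\<Sum>i<m. complex_of_real (\<Sum>k<m. p k * A k i) * u i)"
    unfolding sum_distrib_left of_real_sum sum_distrib_right
    by (subst sum.swap) (simp add: mult_ac)
  also have "\<dots> = (\<Sum>i<m. complex_of_real (p i) * u i)"
    using left by (intro sum.cong) auto
  finally have "(\<Sum>k<m. complex_of_real (p k) * (\<Sum>i<m. complex_of_real (A k i) * u i)) = 0"
    using u0 by simp
  moreover have "(\<Sum>k<m. complex_of_real (p k) * (\<Sum>i<m. complex_of_real (A k i) * u i))
    = l * (\<Sum>k<m. complex_of_real (p k) * u k) + complex_of_real (\<Sum>k<m. p k) * \<kappa>'"
  proof -
    have "(\<Sum>k<m. complex_of_real (p k) * (\<Sum>i<m. complex_of_real (A k i) * u i))
      = (\<Sum>k<m. l * (complex_of_real (p k) * u k) + complex_of_real (p k) * \<kappa>')"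
      by (intro sum.cong refl) (simp add: Au distrib_left mult.left_commute)
    then show ?thesis by (simp add: sum.distrib sum_distrib_left sum_distrib_right)
  qed
  ultimately have \<kappa>0: "\<kappa>' = 0" using u0 p(2) by simp
  \<comment> \<open>The weighted inner product of \<open>A u\<close> with \<open>u\<close> is
    evaluated twice: the eigenvalue equation gives \<open>l * N\<close>, the Gram form gives
    \<open>Q\<close>.\<close>
  define N where "N = (\<Sum>k<m. p k * (cmod (u k))\<^sup>2)"
  define Q where "Q = (\<Sum>j<n. w j * (cmod (\<Sum>k<m. complex_of_real (p k * V k j) * u k))\<^sup>2)"
  have "(\<Sum>k<m. complex_of_real (p k) * cnj (u k) * (\<Sum>i<m. complex_of_real (A k i) * u i))
    = l * complex_of_real N"
  proof -
    have "(\<Sum>k<m. complex_of_real (p k) * cnj (u k) * (\<Sum>i<m. complex_of_real (A k i) * u i))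
      = (\<Sum>k<m. l * complex_of_real (p k * (cmod (u k))\<^sup>2))"
      unfolding of_real_mult complex_norm_square
      by (intro sum.cong refl) (simp only: lessThan_iff Au \<kappa>0 add_0_right, simp add: mult_ac)
    then show ?thesis unfolding N_def by (simp add: sum_distrib_left)
  qed
  moreover have "(\<Sum>k<m. complex_of_real (p k) * cnj (u k) * (\<Sum>i<m. complex_of_real (A k i) * u i))
    = complex_of_real Q"
  proof -
    have "complex_of_real Q = (\<Sum>j<n. complex_of_real (w j) *
      ((\<Sum>i<m. complex_of_real (p i * V i j) * u i) * (\<Sum>k<m. complex_of_real (p k * V k j) * cnj (u k))))"
      unfolding Q_def of_real_sum of_real_mult complex_norm_square by simp
    also have "\<dots> = (\<Sum>j<n. \<Sum>k<m. \<Sum>i<m. complex_of_real (w j * p i * V i j * p k * V k j) * (u i * cnj (u k)))"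
      unfolding sum_distrib_left sum_distrib_right
      by (intro sum.cong refl) (simp add: mult_ac)
    also have "\<dots> = (\<Sum>k<m. \<Sum>i<m. \<Sum>j<n. complex_of_real (w j * p i * V i j * p k * V k j) * (u i * cnj (u k)))"
      by (subst sum.swap, rule sum.cong[OF refl], subst sum.swap, rule refl)
    also have "\<dots> = (\<Sum>k<m. complex_of_real (p k) * cnj (u k) * (\<Sum>i<m. complex_of_real (A k i) * u i))"
      unfolding A sum_distrib_left of_real_mult of_real_sum sum_distrib_right
      by (simp add: mult_ac)
    finally show ?thesis by simp
  qed
  ultimately have lN: "l * complex_of_real N = complex_of_real Q" by simp
  \<comment> \<open>Since \<open>v\<close> is not constant, it cannot equal its mean
    \<open>a\<close> at both indices; hence \<open>N > 0\<close>.\<close>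
  have "u k0 \<noteq> 0 \<or> u 0 \<noteq> 0" using k0 by (auto simp: u_def)
  then obtain k1 where k1: "k1 < m" "u k1 \<noteq> 0" using k0 m by blast
  have "p k1 * (cmod (u k1))\<^sup>2 \<le> N" unfolding N_def
    using k1 p(1) by (intro member_le_sum) (auto simp: less_imp_le)
  then have N: "N > 0" using k1 p(1)[of k1]
    by (meson less_le_trans mult_pos_pos zero_less_norm_iff zero_less_power)
  have Q: "Q \<ge> 0" unfolding Q_def using w by (intro sum_nonneg) auto
  have l: "l = complex_of_real (Q / N)" using lN N by (simp add: field_simps)
  show "l = complex_of_real (Re l)" unfolding l by simp
  show "Re l \<ge> 0" unfolding l using N Q by simp
qed

text \<open>All row sums are \<open>1 - s + (s - 1) = 0\<close>, so constants account for the
  eigenvalue 0. The rank-one term with rows \<open>b\<close> only adds constants and is invisible in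
  the quotient; a quotient eigenvector lifts back whenever \<open>t\<close> is nonzero.\<close>

lemma eigenvalue_shifted_mat:
  fixes A :: "nat \<Rightarrow> nat \<Rightarrow> complex"
  assumes m: "m > 0" and rows: "\<And>k. k < m \<Longrightarrow> (\<Sum>i<m. A k i) = 1"
    and b: "(\<Sum>i<m. b i) = s - 1" and s: "s \<noteq> 0"
  shows "eigenvalue (mat m m (\<lambda>(k, i). (if k = i then 1 else 0) - s * A k i + b i)) t \<longleftrightarrow>
    t = 0 \<or> (\<exists>l. eigenvalue (quotient_mat m A) l \<and> t = 1 - s * l)"
    (is "eigenvalue ?R t \<longleftrightarrow> _")
proof -
  define \<beta> where "\<beta> v = (\<Sum>i<m. b i * v i)" for v
  have R: "(\<Sum>i<m. ((if k = i then 1 else 0) - s * A k i + b i) * v i)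
      = v k - s * (\<Sum>i<m. A k i * v i) + \<beta> v" if "k < m" for k v
  proof -
    have "(\<Sum>i<m. (if k = i then 1 else 0) * v i) = (\<Sum>i<m. if k = i then v i else 0)"
      by (intro sum.cong) auto
    also have "\<dots> = v k" using that by simp
    finally show ?thesis
      unfolding \<beta>_def by (simp add: algebra_simps sum.distrib sum_subtractf sum_distrib_left)
  qed
  have R_iff: "eigenvalue ?R t \<longleftrightarrow>
      (\<exists>v. (\<exists>i<m. v i \<noteq> 0) \<and> (\<forall>k<m. v k - s * (\<Sum>i<m. A k i * v i) + \<beta> v = t * v k))" for t
    unfolding eigenvalue_mat_iff by (simp add: R cong: conj_cong)
  have ones: "(\<Sum>i<m. A k i * a) = a" if "k < m" for k a
    using rows that by (simp flip: sum_distrib_right)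
  have bconst: "\<beta> (\<lambda>_. a) = (s - 1) * a" for a
    unfolding \<beta>_def using b by (simp flip: sum_distrib_right)
  have zero: "eigenvalue ?R 0"
    unfolding R_iff
  proof (intro exI[of _ "\<lambda>_. 1"] conjI)
    show "\<exists>i<m. (1 :: complex) \<noteq> 0" using m by auto
    show "\<forall>k<m. 1 - s * (\<Sum>i<m. A k i * 1) + \<beta> (\<lambda>_. 1) = 0 * 1"
      unfolding bconst by (simp add: rows)
  qed
  have quot: "eigenvalue (quotient_mat m A) l \<longleftrightarrow>
    (\<exists>v \<kappa>. (\<exists>k<m. v k \<noteq> v 0) \<and> (\<forall>k<m. (\<Sum>i<m. A k i * v i) = l * v k + \<kappa>))" for l
    by (rule eigenvalue_quotient_mat[OF m rows])
  show ?thesis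
  proof
    assume "eigenvalue ?R t"
    then obtain v i0 where i0: "i0 < m" "v i0 \<noteq> 0"
      and e: "\<And>k. k < m \<Longrightarrow> v k - s * (\<Sum>i<m. A k i * v i) + \<beta> v = t * v k"
      unfolding R_iff by blast
    show "t = 0 \<or> (\<exists>l. eigenvalue (quotient_mat m A) l \<and> t = 1 - s * l)"
    proof (cases "\<exists>k<m. v k \<noteq> v 0")
      case True
      \<comment> \<open>Solved for \<open>A v\<close>, the eigenvalue equation has the contribution
        \<open>\<beta> v\<close> of \<open>b\<close> as its additive constant.\<close>
      have "(\<Sum>i<m. A k i * v i) = (1 - t) / s * v k + \<beta> v / s" if "k < m" for k
        using e[OF that] s by (simp add: field_simps)
      with True have "eigenvalue (quotient_mat m A) ((1 - t) / s)"
        unfolding quot by blast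
      then show ?thesis using s by (intro disjI2 exI[of _ "(1 - t) / s"]) simp
    next
      case False
      define a where "a = v 0"
      have v: "v k = a" if "k < m" for k using that False unfolding a_def by blast
      have "(\<Sum>i<m. A 0 i * v i) = a" using v ones[OF m, of a] by simp
      moreover have "\<beta> v = (s - 1) * a" using v bconst[of a] unfolding \<beta>_def by simp
      ultimately have "t * a = 0" using e[OF m] v[OF m] by (simp add: algebra_simps)
      then show ?thesis using i0 v by simp
    qed
  next
    assume "t = 0 \<or> (\<exists>l. eigenvalue (quotient_mat m A) l \<and> t = 1 - s * l)"
    then show "eigenvalue ?R t"
    proof (cases "t = 0")
      case True
      then show ?thesis using zero by simp
    next
      case False
      assume "t = 0 \<or> (\<exists>l. eigenvalue (quotient_mat m A) l \<and> t = 1 - s * l)"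
      with False obtain l where l: "eigenvalue (quotient_mat m A) l" and t: "t = 1 - s * l" by blast
      then obtain v \<kappa> k0 where k0: "k0 < m" "v k0 \<noteq> v 0"
        and e: "\<And>k. k < m \<Longrightarrow> (\<Sum>i<m. A k i * v i) = l * v k + \<kappa>"
        unfolding quot by blast
      \<comment> \<open>Adding a constant \<open>a\<close> to \<open>v\<close> leaves the image
        under the matrix unchanged but adds \<open>t * a\<close> to the right-hand side. This choice
        absorbs the discrepancy \<open>\<beta> v - s * \<kappa>\<close>.\<close>
      define a where "a = (\<beta> v - s * \<kappa>) / t"
      have "v k + a - s * (\<Sum>i<m. A k i * (v i + a)) + \<beta> (\<lambda>i. v i + a) = t * (v k + a)"
        if "k < m" for k
      proof -
        have 1: "(\<Sum>i<m. A k i * (v i + a)) = l * v k + \<kappa> + a"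
          using e[OF that] ones[OF that, of a] by (simp add: distrib_left sum.distrib)
        have 2: "\<beta> (\<lambda>i. v i + a) = \<beta> v + (s - 1) * a"
          using bconst[of a] unfolding \<beta>_def by (simp add: distrib_left sum.distrib)
        have "t * a = \<beta> v - s * \<kappa>" unfolding a_def using False by simp
        then show ?thesis unfolding 1 2 by (simp add: t algebra_simps)
      qed
      moreover have "\<exists>i<m. v i + a \<noteq> 0"
      proof (cases "v 0 + a = 0")
        case True
        then have "v k0 + a \<noteq> 0" using k0(2) by (metis add_right_cancel)
        then show ?thesis using k0(1) by blast
      next
        case False
        then show ?thesis using m by blast
      qed
      ultimately show ?thesis unfolding R_iff by (intro exI[of _ "\<lambda>i. v i + a"]) blast
    qed
  qed
qed

text \<open>Maximum principle: at an index \<open>K\<close> where the eigenvector has largest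
  modulus, \<open>(1 - t) * v K\<close> is an average of its entries.\<close>

lemma eigenvalue_row_stochastic_complement:
  fixes T :: "nat \<Rightarrow> nat \<Rightarrow> real"
  assumes T: "\<And>k i. k < m \<Longrightarrow> i < m \<Longrightarrow> T k i \<ge> 0" "\<And>k. k < m \<Longrightarrow> (\<Sum>i<m. T k i) = 1"
    and ev: "eigenvalue (mat m m (\<lambda>(k, i). complex_of_real ((if k = i then 1 else 0) - T k i))) t"
  shows "cmod (1 - t) \<le> 1"
proof -
  from ev obtain v i0 where i0: "i0 < m" "v i0 \<noteq> 0"
    and e: "\<And>k. k < m \<Longrightarrow> (\<Sum>i<m. complex_of_real ((if k = i then 1 else 0) - T k i) * v i) = t * v k"
    unfolding eigenvalue_mat_iff by blast
  have fin: "finite ((\<lambda>k. cmod (v k)) ` {..<m})" and ne: "(\<lambda>k. cmod (v k)) ` {..<m} \<noteq> {}"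
    using i0 by auto
  obtain K where K: "K < m" "Max ((\<lambda>k. cmod (v k)) ` {..<m}) = cmod (v K)"
    using Max_in[OF fin ne] by auto
  have le: "cmod (v i) \<le> cmod (v K)" if "i < m" for i
    using Max_ge[OF fin, of "cmod (v i)"] K that by auto
  have pos: "cmod (v K) > 0" using le[OF i0(1)] i0(2) by (meson less_le_trans zero_less_norm_iff)
  have "(\<Sum>i<m. complex_of_real ((if K = i then 1 else 0) - T K i) * v i)
    = (\<Sum>i<m. if K = i then v i else 0) - (\<Sum>i<m. complex_of_real (T K i) * v i)"
    unfolding sum_subtractf[symmetric] by (intro sum.cong) (auto simp: algebra_simps)
  then have "(1 - t) * v K = (\<Sum>i<m. complex_of_real (T K i) * v i)"
    using e[OF K(1)] K(1) by (simp add: algebra_simps)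
  then have "cmod (1 - t) * cmod (v K) = cmod (\<Sum>i<m. complex_of_real (T K i) * v i)"
    by (metis norm_mult)
  also have "\<dots> \<le> (\<Sum>i<m. T K i * cmod (v K))"
    using T(1)[OF K(1)] le
    by (intro order_trans[OF norm_sum] sum_mono) (auto simp: norm_mult intro!: mult_left_mono)
  also have "\<dots> = cmod (v K)" using T(2)[OF K(1)] by (simp flip: sum_distrib_right)
  finally show ?thesis using pos by simp
qed

text \<open>Since every \<open>s * l\<close> lies in the unit interval, the modulus of
  \<open>1 - s * l\<close> decreases in \<open>l\<close>, and the least \<open>l\<close> gives the
  largest one. The condition \<open>m \<ge> 2\<close> makes the quotient nontrivial, so that the
  minimum exists.\<close>

lemma spectral_radius_shifted_mat:
  fixes V :: "nat \<Rightarrow> nat \<Rightarrow> real" and p w b :: "nat \<Rightarrow> real"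
  assumes m: "m \<ge> 2" and p: "\<And>k. k < m \<Longrightarrow> p k > 0" "(\<Sum>k<m. p k) = 1"
    and w: "\<And>j. j < n \<Longrightarrow> w j \<ge> 0"
    and A: "\<And>k i. A k i = p i * (\<Sum>j<n. w j * V k j * V i j)"
    and rows: "\<And>k. k < m \<Longrightarrow> (\<Sum>i<m. A k i) = 1"
    and b: "(\<Sum>i<m. b i) = s - 1" and s: "s > 0"
    and T: "\<And>k i. k < m \<Longrightarrow> i < m \<Longrightarrow> s * A k i - b i \<ge> 0"
  defines "\<mu> \<equiv> Min (Re ` spectrum (quotient_mat m (\<lambda>k i. complex_of_real (A k i))))"
  shows "\<mu> \<ge> 0"
    and "spectral_radius (mat m m (\<lambda>(k, i). complex_of_real ((if k = i then 1 else 0) - s * A k i + b i)))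
      = 1 - s * \<mu>"
proof -
  define C where "C = quotient_mat m (\<lambda>k i. complex_of_real (A k i))"
  define R where "R = mat m m (\<lambda>(k, i). complex_of_real ((if k = i then 1 else 0) - s * A k i + b i))"
  have C: "C \<in> carrier_mat (m - 1) (m - 1)" unfolding C_def quotient_mat_def by simp
  have RC: "R \<in> carrier_mat m m" unfolding R_def by simp
  have fin: "finite (Re ` spectrum C)" using card_finite_spectrum(1)[OF C] by simp
  have ne: "Re ` spectrum C \<noteq> {}" using spectrum_non_empty[OF C] m by simp
  have m0: "m > 0" using m by simp
  have real: "l = complex_of_real (Re l)" "Re l \<ge> 0" if "eigenvalue C l" for l
    using eigenvalue_gram_quotient_nonneg[OF m0 p w A rows that[unfolded C_def]] by auto
  have \<mu>_mem: "\<mu> \<in> Re ` spectrum C" unfolding \<mu>_def C_def[symmetric] using Min_in[OF fin ne] .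
  then obtain l0 where l0: "eigenvalue C l0" "\<mu> = Re l0" by (auto simp: spectrum_def)
  show \<mu>0: "\<mu> \<ge> 0" using l0 real by simp
  have \<mu>_le: "\<mu> \<le> Re l" if "eigenvalue C l" for l
    unfolding \<mu>_def C_def[symmetric] using that fin by (intro Min_le) (auto simp: spectrum_def)
  have R_alt: "R = mat m m (\<lambda>(k, i). (if k = i then 1 else 0)
      - complex_of_real s * complex_of_real (A k i) + complex_of_real (b i))"
    unfolding R_def by (intro eq_matI) auto
  have Re: "eigenvalue R t \<longleftrightarrow> t = 0 \<or> (\<exists>l. eigenvalue C l \<and> t = 1 - complex_of_real s * l)" for t
    unfolding R_alt C_def
    by (rule eigenvalue_shifted_mat[OF m0])
       (use rows b s in \<open>simp_all flip: of_real_sum\<close>)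
  have R_compl: "R = mat m m (\<lambda>(k, i). complex_of_real ((if k = i then 1 else 0) - (s * A k i - b i)))"
    unfolding R_def by (intro eq_matI) auto
  have le1: "cmod (1 - t) \<le> 1" if "eigenvalue R t" for t
    by (rule eigenvalue_row_stochastic_complement[OF T _ that[unfolded R_compl]])
       (use rows b in \<open>simp_all add: sum_subtractf flip: sum_distrib_left\<close>)
  \<comment> \<open>Here \<open>T\<close> enters: \<open>s * A - 1 b\<close> is row-stochastic,
    which bounds \<open>1 - t = s * l\<close> in modulus.\<close>
  have s_le: "s * Re l \<le> 1" if "eigenvalue C l" for l
  proof -
    have "cmod (complex_of_real s * l) \<le> 1" using le1[of "1 - complex_of_real s * l"] that Re by auto
    moreover have "cmod (complex_of_real s * l) = s * Re l"
      by (subst real(1)[OF that]) (use real(2)[OF that] s in \<open>simp add: norm_mult\<close>)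
    ultimately show ?thesis by simp
  qed
  have norm_eq: "cmod (1 - complex_of_real s * l) = 1 - s * Re l" if "eigenvalue C l" for l
  proof -
    have "1 - complex_of_real s * l = complex_of_real (1 - s * Re l)"
      by (subst real(1)[OF that]) simp
    then show ?thesis using s_le[OF that] by (simp only: norm_of_real abs_of_nonneg diff_ge_0_iff_ge)
  qed
  \<comment> \<open>The extra eigenvalue 0 from the constants does no harm, because
    \<open>1 - s * \<mu>\<close> is itself nonnegative.\<close>
  have up: "x \<le> 1 - s * \<mu>" if x: "x \<in> norm ` spectrum R" for x
  proof -
    from x obtain t where t: "eigenvalue R t" "x = cmod t" by (auto simp: spectrum_def)
    show ?thesis
    proof (cases "t = 0")
      case True
      then show ?thesis using t s_le[OF l0(1)] l0(2) by simp
    next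
      case False
      then obtain l where l: "eigenvalue C l" "t = 1 - complex_of_real s * l" using t Re by blast
      then show ?thesis using t(2) norm_eq[OF l(1)] mult_left_mono[OF \<mu>_le[OF l(1)], of s] s by simp
    qed
  qed
  have mem: "1 - s * \<mu> \<in> norm ` spectrum R"
  proof -
    have "eigenvalue R (1 - complex_of_real s * l0)" unfolding Re using l0(1) by blast
    then show ?thesis using norm_eq[OF l0(1)] l0(2) by (auto simp: spectrum_def image_iff intro!: exI[of _ "1 - complex_of_real s * l0"])
  qed
  have "spectral_radius R = 1 - s * \<mu>"
    using spectral_radius_mem_max[OF RC m0] up mem by (meson antisym)
  then show "spectral_radius (mat m m (\<lambda>(k, i). complex_of_real ((if k = i then 1 else 0) - s * A k i + b i)))
      = 1 - s * \<mu>" unfolding R_def .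
qed

subsection \<open>Existence and uniqueness of the scale\<close>

text \<open>Existence is the intermediate value theorem between 0, where the sum is that of
  \<open>r\<close>, and the reciprocal of the total weight. Uniqueness is strict growth beyond any
  solution.\<close>

lemma ex1_scale_sum_max:
  fixes r w :: "nat \<Rightarrow> real"
  assumes m: "m > 0" and w: "\<And>i. i < m \<Longrightarrow> w i > 0" and r: "\<And>i. i < m \<Longrightarrow> r i \<ge> 0"
    and r_sum: "(\<Sum>i<m. r i) < 1"
  shows "\<exists>!a. a > 0 \<and> (\<Sum>i<m. max (r i) (a * w i)) = 1"
proof -
  define h where "h a = (\<Sum>i<m. max (r i) (a * w i))" for a
  define S where "S = (\<Sum>i<m. w i)"
  have S: "S > 0" unfolding S_def using m w by (intro sum_pos) auto
  have h0: "h 0 < 1" using r r_sum by (simp add: h_def max.absorb1)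
  have "(\<Sum>i<m. 1 / S * w i) \<le> h (1 / S)" unfolding h_def by (intro sum_mono) auto
  moreover have "(\<Sum>i<m. 1 / S * w i) = 1"
    unfolding sum_distrib_left[symmetric] S_def[symmetric] using S by simp
  ultimately have h1: "1 \<le> h (1 / S)" by simp
  have "continuous_on {0..1 / S} h" unfolding h_def by (intro continuous_intros)
  then obtain a where a: "0 \<le> a" "h a = 1"
    using IVT'[of h 0 1 "1 / S"] h0 h1 S by auto
  have "a > 0" using a h0 by (cases "a = 0") auto
  have mono: "h a' > 1" if "0 < a" "a < a'" "h a = 1" for a a'
  proof -
    \<comment> \<open>With every term at its floor \<open>r i\<close> the sum would be below 1; so
      some term exceeds its floor and grows strictly with \<open>a\<close>.\<close>
    have "\<exists>i<m. r i < a * w i"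
    proof (rule ccontr)
      assume "\<not> ?thesis"
      then have "h a = (\<Sum>i<m. r i)" unfolding h_def by (intro sum.cong) (auto simp: max_def)
      then show False using that r_sum by simp
    qed
    then obtain i where i: "i < m" "r i < a * w i" by blast
    have lt: "a * w i < a' * w i" if "i < m" for i using w[OF that] \<open>a < a'\<close> by simp
    have "h a < h a'" unfolding h_def
    proof (rule sum_strict_mono_ex1)
      show "\<forall>i\<in>{..<m}. max (r i) (a * w i) \<le> max (r i) (a' * w i)"
        using max.mono[OF order_refl less_imp_le[OF lt]] by auto
      show "\<exists>i\<in>{..<m}. max (r i) (a * w i) < max (r i) (a' * w i)"
        using i lt[OF i(1)] by (intro bexI[of _ i]) auto
    qed simp
    then show ?thesis using that by simp
  qed
  show ?thesis unfolding h_def[symmetric]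
  proof (rule ex1I[of _ a])
    show "0 < a \<and> h a = 1" using \<open>a > 0\<close> a by simp
    show "b = a" if "0 < b \<and> h b = 1" for b
      using mono[of a b] mono[of b a] that a \<open>a > 0\<close> by (cases a b rule: linorder_cases) auto
  qed
qed

subsection \<open>The matrix rate\<close>

definition mixture :: "real mat \<Rightarrow> real vec \<Rightarrow> nat \<Rightarrow> real" where
  "mixture W q j = (\<Sum>l<dim_row W. q $ l * W $$ (l, j))"

text \<open>The entries of \<open>(I - 1 r) W\<close>, the part of \<open>Wtilde\<close> that is
  free of \<open>f\<close>.\<close>

definition reduced :: "real mat \<Rightarrow> real vec \<Rightarrow> nat \<Rightarrow> nat \<Rightarrow> real" where
  "reduced W r i j = W $$ (i, j) - mixture W r j"

text \<open>The matrix \<open>A\<close> of the overview, arranged as the Gram form that the spectral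
  lemmas expect.\<close>

definition rate_kernel :: "real mat \<Rightarrow> real vec \<Rightarrow> real vec \<Rightarrow> nat \<Rightarrow> nat \<Rightarrow> real" where
  "rate_kernel W phat r k i = limit_point r phat $ i *
     (\<Sum>j<dim_col W. 1 / ((1 - vec_total r)\<^sup>2 * mixture W phat j) * reduced W r k j * reduced W r i j)"

text \<open>The number \<open>\<mu>\<close> of the overview. It is a function of \<open>W\<close>,
  \<open>phat\<close> and \<open>r\<close> alone, which makes the rates for different
  \<open>f\<close> comparable.\<close>

definition rate_gap :: "real mat \<Rightarrow> real vec \<Rightarrow> real vec \<Rightarrow> real" where
  "rate_gap W phat r = Min (Re ` spectrum (quotient_mat (dim_row W)
     (\<lambda>k i. complex_of_real (rate_kernel W phat r k i))))"

section \<open>The transformed matrix of an admissible pair\<close>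

locale admissible_pair =
  fixes W :: "real mat" and r f :: "real vec" and m n :: nat
  assumes W: "W \<in> carrier_mat m n" and stoch: "stochastic W" and adm: "admissible W r f"
    and m: "m \<ge> 2"
begin

abbreviation wt :: "nat \<Rightarrow> nat \<Rightarrow> real" where "wt i j \<equiv> Wtilde W r f $$ (i, j)"

abbreviation denom :: "real vec \<Rightarrow> nat \<Rightarrow> real" where
  "denom p j \<equiv> f $ j + (\<Sum>l<m. p $ l * wt l j)"

lemma dims [simp]: "dim_row W = m" "dim_col W = n" "dim_vec r = m" "dim_vec f = n"
  using W adm by (auto simp: admissible_def)

lemma r_nonneg: "i < m \<Longrightarrow> r $ i \<ge> 0" and f_nonneg: "j < n \<Longrightarrow> f $ j \<ge> 0"
  and r_total: "vec_total r < 1" and wt_nonneg: "i < m \<Longrightarrow> j < n \<Longrightarrow> wt i j \<ge> 0"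
  using adm by (auto simp: admissible_def less_eq_vec_def less_eq_mat_def)

lemma W_nonneg: "i < m \<Longrightarrow> j < n \<Longrightarrow> W $$ (i, j) \<ge> 0"
  and W_row: "i < m \<Longrightarrow> (\<Sum>j<n. W $$ (i, j)) = 1"
  using stoch by (auto simp: stochastic_def less_eq_mat_def vec_total_def)

lemma f_total_nonneg: "vec_total f \<ge> 0"
  unfolding vec_total_def using f_nonneg by (intro sum_nonneg) auto

lemma reduced_nth:
  assumes "i < m" "j < n"
  shows "((1\<^sub>m m - ones_times m r) * W) $$ (i, j) = reduced W r i j"
proof -
  have "((1\<^sub>m m - ones_times m r) * W) $$ (i, j)
    = (\<Sum>l<m. ((if i = l then 1 else 0) - r $ l) * W $$ (l, j))"
    using assms W by (simp add: ones_times_def scalar_prod_def atLeast0LessThan)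
  also have "\<dots> = (\<Sum>l<m. if i = l then W $$ (l, j) else 0) - (\<Sum>l<m. r $ l * W $$ (l, j))"
    unfolding sum_subtractf[symmetric] by (intro sum.cong) (auto simp: algebra_simps)
  also have "\<dots> = reduced W r i j" using assms by (simp add: reduced_def mixture_def)
  finally show ?thesis .
qed

lemma wt_eq:
  assumes "i < m" "j < n"
  shows "wt i j = (1 + vec_total f) / (1 - vec_total r) * reduced W r i j - f $ j"
  using assms W reduced_nth[OF assms] by (simp add: Wtilde_def ones_times_def)

text \<open>A positive multiple of the entry equals \<open>wt i j + f $ j\<close>, a sum of
  nonnegative terms. This is also why \<open>(r, 0)\<close> is admissible.\<close>

lemma reduced_nonneg:
  assumes "i < m" "j < n" shows "reduced W r i j \<ge> 0"
proof -
  define c where "c = (1 + vec_total f) / (1 - vec_total r)"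
  have "c * reduced W r i j \<ge> 0"
    using wt_eq[OF assms] wt_nonneg[OF assms] f_nonneg[OF assms(2)] unfolding c_def by linarith
  moreover have "c > 0"
    using f_total_nonneg r_total by (simp add: c_def)
  ultimately show ?thesis by (simp add: zero_le_mult_iff)
qed

lemma reduced_row: "i < m \<Longrightarrow> (\<Sum>j<n. reduced W r i j) = 1 - vec_total r"
proof -
  assume i: "i < m"
  have "(\<Sum>j<n. mixture W r j) = (\<Sum>l<m. r $ l * (\<Sum>j<n. W $$ (l, j)))"
    unfolding mixture_def sum_distrib_left by (subst sum.swap) simp
  also have "\<dots> = vec_total r" by (simp add: W_row vec_total_def)
  finally show ?thesis by (simp add: reduced_def sum_subtractf W_row i)
qed

lemma wt_row:
  assumes i: "i < m" shows "(\<Sum>j<n. wt i j) = 1"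
proof -
  have "(\<Sum>j<n. wt i j)
    = (1 + vec_total f) / (1 - vec_total r) * (\<Sum>j<n. reduced W r i j) - (\<Sum>j<n. f $ j)"
    unfolding sum_distrib_left sum_subtractf[symmetric] using i by (intro sum.cong) (auto simp: wt_eq)
  then show ?thesis using r_total by (simp add: reduced_row i vec_total_def[of f])
qed

section \<open>Normalization of the algorithm map\<close>

lemma alg_weight_pos: "alg_weight W r f p i > 0"
  by (simp add: alg_weight_def)

lemma alg_weight_total_pos: "(\<Sum>l<m. alg_weight W r f p l) > 0"
  using m alg_weight_pos by (intro sum_pos) (auto simp: lessThan_empty_iff)

lemma ex1_scale: "\<exists>!a. a > 0 \<and> (\<Sum>i<m. max (r $ i) (a * alg_weight W r f p i)) = 1"
  using m r_total by (intro ex1_scale_sum_max alg_weight_pos r_nonneg) (auto simp: vec_total_def)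

lemma alg_scale: "alg_scale W r f p > 0"
    "(\<Sum>i<m. max (r $ i) (alg_scale W r f p * alg_weight W r f p i)) = 1"
  using theI'[OF ex1_scale[of p]] unfolding alg_scale_def by auto

lemma alg_step_nth: "i < m \<Longrightarrow>
    alg_step W r f p $ i = max (r $ i) (alg_scale W r f p * alg_weight W r f p i)"
  by (simp add: alg_step_def)

text \<open>An output strictly above \<open>r\<close> is nowhere truncated, so the scale is the
  reciprocal of the total weight. This serves iterates whose outputs are known to be near the
  limit.\<close>

lemma alg_step_above:
  assumes "\<And>i. i < m \<Longrightarrow> r $ i < alg_step W r f p $ i" and i: "i < m"
  shows "alg_step W r f p $ i = alg_weight W r f p i / (\<Sum>l<m. alg_weight W r f p l)"
proof -
  define a where "a = alg_scale W r f p"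
  have eq: "max (r $ i) (a * alg_weight W r f p i) = a * alg_weight W r f p i" if "i < m" for i
    using assms(1)[OF that] alg_step_nth[OF that, of p] unfolding a_def by (auto simp: max_def split: if_splits)
  have "a * (\<Sum>l<m. alg_weight W r f p l) = 1"
    using alg_scale(2)[of p] eq unfolding a_def[symmetric] by (simp add: sum_distrib_left)
  then have "a = 1 / (\<Sum>l<m. alg_weight W r f p l)"
    using alg_weight_total_pos[of p] by (simp add: field_simps)
  then show ?thesis using alg_step_nth[OF i, of p] eq[OF i] unfolding a_def[symmetric] by simp
qed

text \<open>The counterpart with its condition on the weights: normalized weights above
  \<open>r\<close> already solve the equation for the scale. Neither continuity nor
  differentiability of \<open>alg_scale\<close> then has to be studied.\<close>

lemma alg_step_normalized:
  assumes gt: "\<And>i. i < m \<Longrightarrow> r $ i < alg_weight W r f p i / (\<Sum>l<m. alg_weight W r f p l)" and i: "i < m"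
  shows "alg_step W r f p $ i = alg_weight W r f p i / (\<Sum>l<m. alg_weight W r f p l)"
proof -
  define S where "S = (\<Sum>l<m. alg_weight W r f p l)"
  have S: "S > 0" unfolding S_def by (rule alg_weight_total_pos)
  have eq: "max (r $ i) (1 / S * alg_weight W r f p i) = alg_weight W r f p i / S" if "i < m" for i
    using gt[OF that] unfolding S_def by simp
  have "(\<Sum>i<m. max (r $ i) (1 / S * alg_weight W r f p i)) = (\<Sum>i<m. alg_weight W r f p i / S)"
    by (intro sum.cong refl eq) simp
  also have "\<dots> = 1" using S by (simp add: S_def flip: sum_divide_distrib)
  finally have "alg_scale W r f p = 1 / S"
    unfolding alg_scale_def dims using S by (intro the1_equality ex1_scale) simp
  then show ?thesis using alg_step_nth[OF i, of p] eq[OF i] unfolding S_def by simp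
qed

section \<open>Continuity and differentiation of the weights\<close>

lemma denom_pos:
  assumes p: "\<And>k. k < m \<Longrightarrow> p $ k > 0" and ij: "i < m" "j < n" "wt i j \<noteq> 0"
  shows "denom p j > 0"
proof -
  have "0 < p $ i * wt i j" using p wt_nonneg[OF ij(1,2)] ij by simp
  also have "\<dots> \<le> (\<Sum>l<m. p $ l * wt l j)"
    using p wt_nonneg ij by (intro member_le_sum) (auto simp: less_imp_le)
  finally show ?thesis using f_nonneg[OF ij(2)] by simp
qed

lemma tendsto_alg_weight:
  assumes i: "i < m" and p: "\<And>k. k < m \<Longrightarrow> p $ k > 0"
    and P: "\<And>k. k < m \<Longrightarrow> ((\<lambda>t. P t $ k) \<longlongrightarrow> p $ k) F"
  shows "((\<lambda>t. alg_weight W r f (P t) i) \<longlongrightarrow> alg_weight W r f p i) F"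
proof -
  have "((\<lambda>t. wt i j * ln (Phi W r f (P t) j i)) \<longlongrightarrow> wt i j * ln (Phi W r f p j i)) F" if j: "j < n" for j
  \<comment> \<open>A term with \<open>wt i j = 0\<close> is constantly 0, whatever
    \<open>ln\<close> and division return there; otherwise \<open>denom_pos\<close> keeps the
    denominator positive.\<close>
  proof (cases "wt i j = 0")
    case False
    then have D: "denom p j > 0" and w: "wt i j > 0"
      using denom_pos[of p, OF p i j] wt_nonneg[OF i j] by auto
    have "((\<lambda>t. Phi W r f (P t) j i) \<longlongrightarrow> Phi W r f p j i) F"
      unfolding Phi_def dims using P i D by (intro tendsto_intros) auto
    moreover have "Phi W r f p j i > 0"
      unfolding Phi_def dims using D w p[OF i] by simp
    ultimately show ?thesis by (intro tendsto_intros) auto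
  qed simp
  then show ?thesis unfolding alg_weight_def dims
    by (intro tendsto_exp tendsto_add tendsto_const tendsto_sum) auto
qed

text \<open>The second factor is the logarithmic derivative of the weight.\<close>

lemma has_derivative_alg_weight:
  assumes i: "i < m" and k: "k < m" and p: "\<And>k. k < m \<Longrightarrow> p $ k > 0" and dim: "dim_vec p = m"
  shows "((\<lambda>x. alg_weight W r f (p |\<^sub>v k \<mapsto> x) i) has_real_derivative
    alg_weight W r f p i *
      ((if k = i then 1 / p $ k else 0) - (\<Sum>j<n. wt i j * wt k j / denom p j))) (at (p $ k))"
proof -
  have upd: "(p |\<^sub>v k \<mapsto> x) $ l = (if l = k then x else p $ l)" if "l < m" for l x
    using that dim k by simp
  have upd_id: "p |\<^sub>v k \<mapsto> (p $ k) = p" using dim by (intro eq_vecI) (auto simp: update_vec_def)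
  \<comment> \<open>The denominator is affine in the varied coordinate, so each term becomes an
    explicit function of \<open>x\<close>.\<close>
  have denom_upd: "denom (p |\<^sub>v k \<mapsto> x) j = denom p j + (x - p $ k) * wt k j" for x j
  proof -
    have "(\<Sum>l<m. (p |\<^sub>v k \<mapsto> x) $ l * wt l j)
      = (\<Sum>l<m. p $ l * wt l j + (if l = k then (x - p $ k) * wt k j else 0))"
      by (intro sum.cong) (auto simp: upd algebra_simps)
    also have "\<dots> = (\<Sum>l<m. p $ l * wt l j) + (x - p $ k) * wt k j"
      using k by (simp add: sum.distrib)
    finally show ?thesis by simp
  qed
  have term_deriv: "((\<lambda>x. wt i j * ln (Phi W r f (p |\<^sub>v k \<mapsto> x) j i)) has_real_derivative
      wt i j * ((if k = i then 1 / p $ k else 0) - wt k j / denom p j)) (at (p $ k))" if j: "j < n" for j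
  proof (cases "wt i j = 0")
    case False
    define D where "D = denom p j"
    have D: "D > 0" and w: "wt i j > 0"
      using denom_pos[of p, OF p i j] wt_nonneg[OF i j] False by (auto simp: D_def)
    have Phi: "Phi W r f (p |\<^sub>v k \<mapsto> x) j i
        = (if k = i then x else p $ i) * wt i j / (D + (x - p $ k) * wt k j)" for x
      unfolding Phi_def dims denom_upd D_def using upd[OF i] by simp
    show ?thesis
    proof (cases "k = i")
      case True
      show ?thesis unfolding Phi D_def[symmetric] using True D w p[OF i]
        by (auto intro!: derivative_eq_intros simp: field_simps)
    next
      case False
      show ?thesis unfolding Phi D_def[symmetric] using False D w p[OF i]
        by (auto intro!: derivative_eq_intros simp: field_simps)
    qed
  qed simp
  have "((\<lambda>x. alg_weight W r f (p |\<^sub>v k \<mapsto> x) i) has_real_derivative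
    exp (cvec W r f $ i + (\<Sum>j<n. wt i j * ln (Phi W r f (p |\<^sub>v k \<mapsto> (p $ k)) j i))) *
      (0 + (\<Sum>j<n. wt i j * ((if k = i then 1 / p $ k else 0) - wt k j / denom p j)))) (at (p $ k))"
    unfolding alg_weight_def dims
    by (intro DERIV_fun_exp DERIV_add DERIV_const DERIV_sum term_deriv) simp
  \<comment> \<open>Row sums 1 of \<open>Wtilde\<close> collapse the diagonal contributions to a
    single \<open>1 / p $ k\<close>.\<close>
  also have "(\<Sum>j<n. wt i j * ((if k = i then 1 / p $ k else 0) - wt k j / denom p j))
    = (if k = i then 1 / p $ k else 0) - (\<Sum>j<n. wt i j * wt k j / denom p j)"
    by (simp add: right_diff_distrib sum_subtractf wt_row i flip: sum_divide_distrib sum_distrib_right)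
  finally show ?thesis unfolding upd_id alg_weight_def dims by simp
qed

text \<open>Quotient rule for weight over total weight, with \<open>B\<close> the logarithmic
  derivatives. At a fixed point the weights are proportional to \<open>p\<close>, so the total
  cancels and \<open>B i\<close> minus its \<open>p\<close>-mean remains.\<close>

lemma matrix_rate_at_fixed_point:
  assumes p: "\<And>k. k < m \<Longrightarrow> p $ k > 0" and dim: "dim_vec p = m"
    and fixp: "\<And>i. i < m \<Longrightarrow> p $ i = alg_weight W r f p i / (\<Sum>l<m. alg_weight W r f p l)"
    and gt: "\<And>i. i < m \<Longrightarrow> r $ i < p $ i"
    and k: "k < m" and i: "i < m"
  defines "B \<equiv> \<lambda>i. (if k = i then 1 / p $ k else 0) - (\<Sum>j<n. wt i j * wt k j / denom p j)"
  shows "matrix_rate W r f p $$ (k, i) = p $ i * (B i - (\<Sum>l<m. p $ l * B l))"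
proof -
  define S where "S q = (\<Sum>l<m. alg_weight W r f q l)" for q
  have S: "S q > 0" for q unfolding S_def by (rule alg_weight_total_pos)
  have upd_id: "p |\<^sub>v k \<mapsto> (p $ k) = p" using dim by (intro eq_vecI) (auto simp: update_vec_def)
  \<comment> \<open>The filter \<open>nhds\<close> includes the point itself: replacing the function
    under the derivative requires agreement there too.\<close>
  have upd_tendsto: "((\<lambda>x. (p |\<^sub>v k \<mapsto> x) $ l) \<longlongrightarrow> p $ l) (nhds (p $ k))" if "l < m" for l
    using that dim k by (cases "l = k") (auto simp: filterlim_ident)
  have weight_tendsto: "((\<lambda>x. alg_weight W r f (p |\<^sub>v k \<mapsto> x) l) \<longlongrightarrow> alg_weight W r f p l) (nhds (p $ k))"
    if "l < m" for l using that p upd_tendsto by (intro tendsto_alg_weight)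
  \<comment> \<open>The strict inequality at the fixed point is an open condition, so truncation
    stays inactive nearby.\<close>
  have "\<forall>\<^sub>F x in nhds (p $ k). r $ l < alg_weight W r f (p |\<^sub>v k \<mapsto> x) l / S (p |\<^sub>v k \<mapsto> x)"
    if l: "l < m" for l
  proof (rule order_tendstoD(1))
    show "((\<lambda>x. alg_weight W r f (p |\<^sub>v k \<mapsto> x) l / S (p |\<^sub>v k \<mapsto> x)) \<longlongrightarrow> alg_weight W r f p l / S p) (nhds (p $ k))"
      unfolding S_def using S[of p, unfolded S_def] l
      by (intro tendsto_intros weight_tendsto) auto
    show "r $ l < alg_weight W r f p l / S p" using gt fixp l by (simp add: S_def)
  qed
  then have "\<forall>\<^sub>F x in nhds (p $ k). \<forall>l\<in>{..<m}. r $ l < alg_weight W r f (p |\<^sub>v k \<mapsto> x) l / S (p |\<^sub>v k \<mapsto> x)"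
    by (intro eventually_ball_finite) auto
  then have ev: "\<forall>\<^sub>F x in nhds (p $ k). alg_step W r f (p |\<^sub>v k \<mapsto> x) $ i
      = alg_weight W r f (p |\<^sub>v k \<mapsto> x) i / S (p |\<^sub>v k \<mapsto> x)"
    by eventually_elim (use alg_step_normalized[OF _ i] in \<open>auto simp: S_def\<close>)
  have dw: "((\<lambda>x. alg_weight W r f (p |\<^sub>v k \<mapsto> x) l) has_real_derivative alg_weight W r f p l * B l) (at (p $ k))"
    if "l < m" for l unfolding B_def by (rule has_derivative_alg_weight[OF that k p dim])
  have dS: "((\<lambda>x. S (p |\<^sub>v k \<mapsto> x)) has_real_derivative (\<Sum>l<m. alg_weight W r f p l * B l)) (at (p $ k))"
    unfolding S_def by (intro DERIV_sum dw) auto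
  have w: "alg_weight W r f p l = S p * p $ l" if "l < m" for l
    using fixp[OF that] S[of p] by (simp add: S_def[symmetric] field_simps)
  have "((\<lambda>x. alg_weight W r f (p |\<^sub>v k \<mapsto> x) i / S (p |\<^sub>v k \<mapsto> x)) has_real_derivative
    (alg_weight W r f p i * B i * S p - alg_weight W r f p i * (\<Sum>l<m. alg_weight W r f p l * B l)) / (S p * S p))
      (at (p $ k))"
    using DERIV_divide[OF dw[OF i] dS] S[of p] unfolding upd_id by simp
  also have "(alg_weight W r f p i * B i * S p - alg_weight W r f p i * (\<Sum>l<m. alg_weight W r f p l * B l)) / (S p * S p)
    = p $ i * (B i - (\<Sum>l<m. p $ l * B l))"
  proof -
    have "(\<Sum>l<m. alg_weight W r f p l * B l) = S p * (\<Sum>l<m. p $ l * B l)"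
      unfolding sum_distrib_left by (intro sum.cong) (auto simp: w)
    then show ?thesis using S[of p] by (simp add: w[OF i] field_simps)
  qed
  finally have "((\<lambda>x. alg_step W r f (p |\<^sub>v k \<mapsto> x) $ i) has_real_derivative
      p $ i * (B i - (\<Sum>l<m. p $ l * B l))) (at (p $ k))"
    using DERIV_cong_ev[OF refl ev refl] by blast
  then show ?thesis unfolding matrix_rate_def using k i by (simp add: DERIV_imp_deriv)
qed

end

section \<open>The matrix rate at the limit of the algorithm\<close>

locale algorithm_output = admissible_pair +
  fixes phat :: "real vec"
  assumes cols: "\<forall>j<n. col W j \<noteq> 0\<^sub>v m" and phat: "phat \<in> carrier_vec m"
    and phat_pos: "\<forall>i<m. phat $ i > 0" and final: "final_output W r f phat"
begin

abbreviation p :: "real vec" where "p \<equiv> limit_point r phat"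

lemma p_nth: "i < m \<Longrightarrow> p $ i = (1 - vec_total r) * phat $ i + r $ i"
  using phat by (simp add: limit_point_def)

lemma dim_p [simp]: "dim_vec p = m"
  using phat by (simp add: limit_point_def)

lemma p_gt: "i < m \<Longrightarrow> r $ i < p $ i"
  using phat_pos r_total by (simp add: p_nth)

lemma p_pos: "i < m \<Longrightarrow> p $ i > 0"
  using p_gt r_nonneg by (meson le_less_trans)

text \<open>The limit lies strictly above \<open>r\<close>, so late iterates are normalized weights.
  These converge by continuity of the weights, while the shifted sequence of iterates has the same
  limit as the original one.\<close>

lemma p_fixed:
  assumes i: "i < m" shows "p $ i = alg_weight W r f p i / (\<Sum>l<m. alg_weight W r f p l)"
proof -
  obtain p0 pstar where pstar: "pstar \<in> carrier_vec m"
    and lim: "\<And>i. i < m \<Longrightarrow> (\<lambda>t. (alg_step W r f ^^ t) p0 $ i) \<longlonglongrightarrow> pstar $ i"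
    and eq: "phat = (1 / (1 - vec_total r)) \<cdot>\<^sub>v (pstar - r)"
    using final unfolding final_output_def dims by blast
  define P where "P t = (alg_step W r f ^^ t) p0" for t
  \<comment> \<open>\<open>limit_point\<close> inverts the affine map from the limit to the final
    output.\<close>
  have "p $ i = pstar $ i" if "i < m" for i
  proof -
    have "phat $ i = (pstar $ i - r $ i) / (1 - vec_total r)" using that pstar by (simp add: eq)
    then show ?thesis using r_total by (simp add: p_nth[OF that])
  qed
  then have lim: "(\<lambda>t. P t $ i) \<longlonglongrightarrow> p $ i" if "i < m" for i
    using lim that unfolding P_def by simp
  then have limS: "(\<lambda>t. alg_step W r f (P t) $ i) \<longlonglongrightarrow> p $ i" if "i < m" for i
    using LIMSEQ_Suc[OF lim[OF that]] by (simp add: P_def)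
  have w: "(\<lambda>t. alg_weight W r f (P t) i) \<longlonglongrightarrow> alg_weight W r f p i" if "i < m" for i
    using that p_pos lim by (intro tendsto_alg_weight) auto
  have "(\<lambda>t. alg_weight W r f (P t) i / (\<Sum>l<m. alg_weight W r f (P t) l))
      \<longlonglongrightarrow> alg_weight W r f p i / (\<Sum>l<m. alg_weight W r f p l)"
    using i alg_weight_total_pos[of p] by (intro tendsto_intros w) auto
  moreover have "\<forall>\<^sub>F t in sequentially. \<forall>i\<in>{..<m}. r $ i < alg_step W r f (P t) $ i"
    using order_tendstoD(1)[OF limS p_gt] by (intro eventually_ball_finite) auto
  then have "\<forall>\<^sub>F t in sequentially. alg_step W r f (P t) $ i
      = alg_weight W r f (P t) i / (\<Sum>l<m. alg_weight W r f (P t) l)"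
    by eventually_elim (use alg_step_above[OF _ i] in auto)
  ultimately have "(\<lambda>t. alg_step W r f (P t) $ i)
      \<longlonglongrightarrow> alg_weight W r f p i / (\<Sum>l<m. alg_weight W r f p l)"
    by (rule tendsto_cong[THEN iffD2, rotated])
  then show ?thesis using limS[OF i] LIMSEQ_unique by blast
qed

text \<open>The total is read off from the fixed point, whose entries are normalized
  weights.\<close>

lemma p_sum: "(\<Sum>i<m. p $ i) = 1"
proof -
  have "(\<Sum>i<m. p $ i) = (\<Sum>i<m. alg_weight W r f p i / (\<Sum>l<m. alg_weight W r f p l))"
    by (intro sum.cong refl p_fixed) simp
  then show ?thesis using alg_weight_total_pos[of p] by (simp flip: sum_divide_distrib)
qed

lemma mixture_pos: assumes j: "j < n" shows "mixture W phat j > 0"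
proof -
  obtain l where l: "l < m" "W $$ (l, j) \<noteq> 0"
  proof (rule ccontr)
    assume "\<not> thesis"
    with that have "col W j = 0\<^sub>v m" using j by (intro eq_vecI) auto
    then show False using cols j by blast
  qed
  have "0 < phat $ l * W $$ (l, j)" using phat_pos l W_nonneg[OF l(1) j] by simp
  also have "\<dots> \<le> mixture W phat j" unfolding mixture_def dims
    using l phat_pos W_nonneg j by (intro member_le_sum) (auto simp: less_imp_le)
  finally show ?thesis .
qed

text \<open>As \<open>p = (1 - r_+) phat + r\<close>, the row \<open>p W\<close> contains
  \<open>r W\<close>, which is exactly what \<open>reduced\<close> subtracts.\<close>

lemma sum_p_reduced:
  assumes "j < n" shows "(\<Sum>i<m. p $ i * reduced W r i j) = (1 - vec_total r) * mixture W phat j"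
proof -
  have "(\<Sum>i<m. p $ i * reduced W r i j)
    = (\<Sum>i<m. p $ i * W $$ (i, j)) - (\<Sum>i<m. p $ i) * mixture W r j"
    unfolding reduced_def by (simp add: right_diff_distrib sum_subtractf sum_distrib_right)
  also have "(\<Sum>i<m. p $ i * W $$ (i, j)) = (1 - vec_total r) * mixture W phat j + mixture W r j"
    unfolding mixture_def dims sum_distrib_left sum.distrib[symmetric]
    by (intro sum.cong) (auto simp: p_nth algebra_simps)
  finally show ?thesis by (simp add: p_sum)
qed

text \<open>The \<open>f\<close> added in the denominator of \<open>Phi\<close> cancels the
  \<open>f\<close> subtracted in \<open>Wtilde\<close>, because \<open>p\<close> has total 1. Only
  the factor \<open>1 + vec_total f\<close> survives, and the separation of \<open>f\<close> from
  the kernel rests on this.\<close>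

lemma denom_p:
  assumes "j < n" shows "denom p j = (1 + vec_total f) * mixture W phat j"
proof -
  have "(\<Sum>l<m. p $ l * wt l j)
    = (\<Sum>l<m. (1 + vec_total f) / (1 - vec_total r) * (p $ l * reduced W r l j) - p $ l * f $ j)"
    using assms by (intro sum.cong) (auto simp: wt_eq algebra_simps)
  also have "\<dots> = (1 + vec_total f) / (1 - vec_total r) * (\<Sum>l<m. p $ l * reduced W r l j)
      - (\<Sum>l<m. p $ l) * f $ j"
    by (simp add: sum_subtractf sum_distrib_left sum_distrib_right)
  also have "\<dots> = (1 + vec_total f) * mixture W phat j - f $ j"
    using r_total assms by (simp add: p_sum sum_p_reduced)
  finally show ?thesis by simp
qed

text \<open>The row \<open>b\<close> of the overview; it is independent of the row index
  \<open>k\<close> of the matrix rate.\<close>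

definition offset :: "nat \<Rightarrow> real" where
  "offset i = p $ i * (\<Sum>j<n. f $ j * reduced W r i j / ((1 - vec_total r) * mixture W phat j))"

text \<open>Here \<open>wt i j + f $ j\<close> is a multiple of \<open>reduced W r i j\<close>, and
  \<open>wt k j\<close> is the same multiple of \<open>reduced W r k j\<close> minus
  \<open>f $ j\<close>. Expanding the product separates kernel and offset; unexpanded, it has only
  nonnegative factors.\<close>

lemma kernel_minus_offset:
  assumes k: "k < m" and i: "i < m"
  shows "(1 + vec_total f) * rate_kernel W phat r k i - offset i
    = p $ i * (\<Sum>j<n. wt k j * (wt i j + f $ j) / denom p j)"
    (is "_ = p $ i * ?S")
  and "(1 + vec_total f) * rate_kernel W phat r k i - offset i \<ge> 0"
proof -
  have "(1 + vec_total f) * (1 / ((1 - vec_total r)\<^sup>2 * mixture W phat j) * reduced W r k j * reduced W r i j)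
      - f $ j * reduced W r i j / ((1 - vec_total r) * mixture W phat j)
    = wt k j * (wt i j + f $ j) / denom p j" if j: "j < n" for j
  proof -
    have nz: "1 + vec_total f \<noteq> 0" "1 - vec_total r \<noteq> 0" "mixture W phat j \<noteq> 0"
      using f_total_nonneg r_total mixture_pos[OF j] by auto
    show ?thesis unfolding denom_p[OF j] wt_eq[OF k j] wt_eq[OF i j] using nz
      by (simp add: divide_simps) (simp add: algebra_simps power2_eq_square)
  qed
  then have "?S = (\<Sum>j<n. (1 + vec_total f) * (1 / ((1 - vec_total r)\<^sup>2 * mixture W phat j) * reduced W r k j * reduced W r i j)
      - f $ j * reduced W r i j / ((1 - vec_total r) * mixture W phat j))"
    by (intro sum.cong) auto
  then show eq: "(1 + vec_total f) * rate_kernel W phat r k i - offset i = p $ i * ?S"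
    unfolding rate_kernel_def offset_def dims
    by (simp only: sum_subtractf sum_distrib_left[symmetric],
        simp only: right_diff_distrib mult.left_commute)
  have "denom p j \<ge> 0" if "j < n" for j
    using denom_p[OF that] f_total_nonneg mixture_pos[OF that] by simp
  then show "(1 + vec_total f) * rate_kernel W phat r k i - offset i \<ge> 0"
    unfolding eq using k i p_pos[OF i] wt_nonneg f_nonneg
    by (intro mult_nonneg_nonneg sum_nonneg divide_nonneg_nonneg) (auto intro: add_nonneg_nonneg)
qed

lemma matrix_rate_entry:
  assumes k: "k < m" and i: "i < m"
  shows "matrix_rate W r f p $$ (k, i)
    = (if k = i then 1 else 0) - (1 + vec_total f) * rate_kernel W phat r k i + offset i"
proof -
  define B where "B i = (if k = i then 1 / p $ k else 0) - (\<Sum>j<n. wt i j * wt k j / denom p j)" for i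
  have nz: "denom p j \<noteq> 0" if "j < n" for j
    using denom_p[OF that] f_total_nonneg mixture_pos[OF that] by simp
  have "(\<Sum>l<m. p $ l * B l)
    = (\<Sum>l<m. if k = l then 1 else 0) - (\<Sum>l<m. \<Sum>j<n. p $ l * wt l j * wt k j / denom p j)"
    unfolding B_def sum_subtractf[symmetric] using p_pos[OF k]
    by (intro sum.cong) (auto simp: right_diff_distrib sum_distrib_left mult.assoc)
  also have "\<dots> = 1 - (\<Sum>j<n. (\<Sum>l<m. p $ l * wt l j) * wt k j / denom p j)"
    unfolding sum_distrib_right sum_divide_distrib using k by (subst sum.swap) simp
  \<comment> \<open>The 1 is written as a row sum of \<open>Wtilde\<close> so that the sums combine
    termwise: \<open>denom p j\<close> minus its mixture part leaves \<open>f $ j\<close>.\<close>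
  also have "\<dots> = (\<Sum>j<n. wt k j) - (\<Sum>j<n. (\<Sum>l<m. p $ l * wt l j) * wt k j / denom p j)"
    by (simp add: wt_row k)
  also have "\<dots> = (\<Sum>j<n. wt k j * f $ j / denom p j)"
    unfolding sum_subtractf[symmetric] using nz by (intro sum.cong) (auto simp: field_simps)
  finally have sum_B: "(\<Sum>l<m. p $ l * B l) = (\<Sum>j<n. wt k j * f $ j / denom p j)" .
  have "matrix_rate W r f p $$ (k, i) = p $ i * (B i - (\<Sum>l<m. p $ l * B l))"
    unfolding B_def by (rule matrix_rate_at_fixed_point) (use p_pos p_fixed p_gt k i in auto)
  also have "\<dots> = (if k = i then 1 else 0) - p $ i * (\<Sum>j<n. wt k j * (wt i j + f $ j) / denom p j)"
  proof -
    have "(\<Sum>j<n. wt k j * (wt i j + f $ j) / denom p j)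
      = (\<Sum>j<n. wt i j * wt k j / denom p j) + (\<Sum>j<n. wt k j * f $ j / denom p j)"
      by (simp add: distrib_left add_divide_distrib sum.distrib mult.commute)
    then show ?thesis unfolding sum_B unfolding B_def using p_pos[OF i]
      by (auto simp: right_diff_distrib distrib_left)
  qed
  finally show ?thesis using kernel_minus_offset(1)[OF k i] by simp
qed

lemma global_rate_eq:
  "rate_gap W phat r \<ge> 0"
  "global_rate W phat r f = 1 - (1 + vec_total f) * rate_gap W phat r"
proof -
  have r0: "1 - vec_total r \<noteq> 0" using r_total by simp
  have rows: "(\<Sum>i<m. rate_kernel W phat r k i) = 1" if k: "k < m" for k
  proof -
    have "(\<Sum>i<m. rate_kernel W phat r k i) = (\<Sum>j<n. 1 / ((1 - vec_total r)\<^sup>2 * mixture W phat j)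
        * reduced W r k j * (\<Sum>i<m. p $ i * reduced W r i j))"
      unfolding rate_kernel_def dims sum_distrib_left by (subst sum.swap) (simp add: mult_ac)
    \<comment> \<open>Summing over \<open>i\<close> first gives \<open>(1 - r_+)\<close> times the
      mixture, which cancels the weight up to one factor \<open>1 - r_+\<close>; the row sums of
      \<open>reduced\<close> cancel that.\<close>
    also have "\<dots> = (\<Sum>j<n. reduced W r k j / (1 - vec_total r))"
    proof (intro sum.cong refl)
      have cancel: "1 / (a\<^sup>2 * q) * x * (a * q) = x / a" if "a \<noteq> 0" "q > 0" for a q x :: real
        using that by (simp add: power2_eq_square)
      fix j assume "j \<in> {..<n}"
      then show "1 / ((1 - vec_total r)\<^sup>2 * mixture W phat j) * reduced W r k j
          * (\<Sum>i<m. p $ i * reduced W r i j) = reduced W r k j / (1 - vec_total r)"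
        using cancel[OF r0 mixture_pos] by (simp only: lessThan_iff sum_p_reduced)
    qed
    also have "\<dots> = 1" using r0 by (simp add: reduced_row k flip: sum_divide_distrib)
    finally show ?thesis .
  qed
  \<comment> \<open>By the same summation the denominators of the offset cancel, leaving the total
    of \<open>f\<close>.\<close>
  have b: "(\<Sum>i<m. offset i) = (1 + vec_total f) - 1"
  proof -
    have "(\<Sum>i<m. offset i) = (\<Sum>j<n. f $ j / ((1 - vec_total r) * mixture W phat j)
        * (\<Sum>i<m. p $ i * reduced W r i j))"
      unfolding offset_def sum_distrib_left by (subst sum.swap) (simp add: mult_ac)
    also have "\<dots> = (\<Sum>j<n. f $ j)"
      by (intro sum.cong) (use r0 in \<open>auto simp: sum_p_reduced dest: mixture_pos\<close>)
    finally show ?thesis by (simp add: vec_total_def)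
  qed
  have s: "1 + vec_total f > 0" using f_total_nonneg by simp
  have w: "1 / ((1 - vec_total r)\<^sup>2 * mixture W phat j) \<ge> 0" if "j < n" for j
    using mixture_pos[OF that] by simp
  have "dim_row (matrix_rate W r f p) = m" "dim_col (matrix_rate W r f p) = m"
    by (simp_all add: matrix_rate_def)
  then have "map_mat complex_of_real (matrix_rate W r f p) = mat m m (\<lambda>(k, i).
      complex_of_real ((if k = i then 1 else 0) - (1 + vec_total f) * rate_kernel W phat r k i + offset i))"
    by (intro eq_matI) (auto simp: matrix_rate_entry)
  then show "rate_gap W phat r \<ge> 0"
    "global_rate W phat r f = 1 - (1 + vec_total f) * rate_gap W phat r"
    using spectral_radius_shifted_mat[OF m p_pos p_sum w rate_kernel_def[unfolded dims] rows b s
        kernel_minus_offset(2)]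
    unfolding global_rate_def rate_gap_def dims by simp_all
qed

end

section \<open>Comparison of rates for a common \<open>r\<close>\<close>

theorem theorem3:
  fixes W :: "real mat" and phat :: "real vec" and m n :: nat
  assumes "W \<in> carrier_mat m n" and "stochastic W"
    and "\<exists>i<m. \<exists>k<m. row W i \<noteq> row W k"
    and "\<forall>j<n. col W j \<noteq> 0\<^sub>v m"
    and "phat \<in> carrier_vec m" and "\<forall>i<m. phat $ i > 0"
  shows "(\<forall>r f. admissible W r f \<and> final_output W r f phat \<and> final_output W r (0\<^sub>v n) phat \<longrightarrow>
            global_rate W phat r f
              = (1 + vec_total f) * global_rate W phat r (0\<^sub>v n) - vec_total f) \<and>
         (\<forall>r f ftilde. admissible W r f \<and> admissible W r ftilde \<and>
            final_output W r f phat \<and> final_output W r ftilde phat \<and>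
            vec_total f \<ge> vec_total ftilde \<longrightarrow>
            global_rate W phat r f \<le> global_rate W phat r ftilde)"
proof -
  have m: "m \<ge> 2"
  proof (rule ccontr)
    assume "\<not> m \<ge> 2"
    then have "i = 0" if "i < m" for i using that by linarith
    then show False using assms(3) by blast
  qed
  \<comment> \<open>The rate is affine in \<open>vec_total f\<close> with a slope that
    \<open>f\<close> does not affect; both claims follow from this and the sign of the gap.\<close>
  have rate: "rate_gap W phat r \<ge> 0"
      "global_rate W phat r f = 1 - (1 + vec_total f) * rate_gap W phat r"
    if "admissible W r f" "final_output W r f phat" for r f
  proof -
    interpret algorithm_output W r f m n phat
      using assms m that by unfold_locales auto
    show "rate_gap W phat r \<ge> 0"
      "global_rate W phat r f = 1 - (1 + vec_total f) * rate_gap W phat r"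
      by (rule global_rate_eq)+
  qed
  have zero_total: "vec_total (0\<^sub>v n) = 0" by (simp add: vec_total_def)
  have adm0: "admissible W r (0\<^sub>v n)" if adm: "admissible W r f" for r f
  proof -
    interpret admissible_pair W r f m n
      using assms m adm by unfold_locales auto
    have "Wtilde W r (0\<^sub>v n) $$ (i, j) = 1 / (1 - vec_total r) * reduced W r i j"
      if "i < m" "j < n" for i j
      using that W reduced_nth[OF that] by (simp add: Wtilde_def ones_times_def zero_total)
    then have "Wtilde W r (0\<^sub>v n) $$ (i, j) \<ge> 0" if "i < m" "j < n" for i j
      using reduced_nonneg[OF that] r_total that by simp
    moreover have "dim_row (Wtilde W r (0\<^sub>v n)) = m" "dim_col (Wtilde W r (0\<^sub>v n)) = n"
      by (simp_all add: Wtilde_def ones_times_def)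
    ultimately have "0\<^sub>m m n \<le> Wtilde W r (0\<^sub>v n)"
      by (simp add: less_eq_mat_def)
    then show ?thesis using adm by (auto simp: admissible_def less_eq_vec_def)
  qed
  show ?thesis
  proof (intro conjI allI impI)
    fix r f
    assume h: "admissible W r f \<and> final_output W r f phat \<and> final_output W r (0\<^sub>v n) phat"
    then have eqs: "global_rate W phat r f = 1 - (1 + vec_total f) * rate_gap W phat r"
      "global_rate W phat r (0\<^sub>v n) = 1 - rate_gap W phat r"
      using rate(2)[of r f] rate(2)[of r "0\<^sub>v n"] adm0[of r f] by (simp_all add: zero_total)
    show "global_rate W phat r f = (1 + vec_total f) * global_rate W phat r (0\<^sub>v n) - vec_total f"
      unfolding eqs by (simp add: algebra_simps)
  next
    fix r f ftilde
    assume h: "admissible W r f \<and> admissible W r ftilde \<and> final_output W r f phat \<and>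
      final_output W r ftilde phat \<and> vec_total f \<ge> vec_total ftilde"
    then have "(1 + vec_total ftilde) * rate_gap W phat r \<le> (1 + vec_total f) * rate_gap W phat r"
      using rate(1)[of r f] by (intro mult_right_mono) auto
    then show "global_rate W phat r f \<le> global_rate W phat r ftilde"
      using rate(2)[of r f] rate(2)[of r ftilde] h by simp
  qed
qed

end
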